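(* For every $\varepsilon>0$ there exists a threshold $n_0$ such that for all integers $m>n>n_0$ we have $$|A_n\cap A_m|<m^{\frac{(2+\varepsilon)\log 2}{\log\log m}}.$$
   Context: For an integer $k\geq 2$, let $A_k=\{r(k-r): r\in\mathbb{Z},\ 1\leq r\leq k-1\}$ (a set of integers). $|X|$ denotes the cardinality of a finite set $X$, and $\log$ is the natural logarithm. *)

theory Defs
  imports Complex_Main
begin

definition A_set :: "int \<Rightarrow> int set" where
  "A_set k = {r * (k - r) | r. 1 \<le> r \<and> r \<le> k - 1}"

end

theory Submission
  imports Defs "HOL-Computational_Algebra.Primes" "HOL-Library.FuncSet" "HOL-Real_Asymp.Real_Asymp"
begin

text \<open>If \<open>r (n - r) = s (m - s)\<close> and \<open>u = m - 2 s\<close>, \<open>v = n - 2 r\<close>, then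
  \<open>(u + v) (u - v) = m\<^sup>2 - n\<^sup>2\<close>, and the divisor \<open>\<bar>u + v\<bar>\<close> determines the common
  value. So the intersection has at most \<open>d(m\<^sup>2 - n\<^sup>2)\<close> elements, and Wigert's bound
  \<open>d(N) \<le> X powr ((1 + o(1)) ln 2 / ln (ln X))\<close> for \<open>N \<le> X = m\<^sup>2\<close> finishes the proof.\<close>

text \<open>A divisor is determined by its exponents at the primes dividing \<open>n\<close>: at any
  other prime its exponent is 0. Each exponent lies between 0 and that of \<open>n\<close>, so the
  divisors inject into a finite product of intervals.\<close>

lemma card_divisors_le:
  fixes n :: nat
  assumes "n > 0"
  shows "card {d. d dvd n} \<le> (\<Prod>p\<in>prime_factors n. multiplicity p n + 1)"
proof -
  let ?P = "prime_factors n"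
  let ?F = "\<lambda>d. restrict (\<lambda>p. multiplicity p d) ?P"
  have "inj_on ?F {d. d dvd n}"
  proof (rule inj_onI)
    fix d e assume d: "d \<in> {d. d dvd n}" and e: "e \<in> {d. d dvd n}" and eq: "?F d = ?F e"
    have pos: "d > 0" "e > 0" using d e assms by (auto intro: dvd_pos_nat)
    have "multiplicity p d = multiplicity p e" if p: "prime p" for p
    proof (cases "p \<in> ?P")
      case True
      then show ?thesis using fun_cong[OF eq, of p] by simp
    next
      case False
      then have "\<not> p dvd n" using p assms by (simp add: in_prime_factors_iff)
      then have "\<not> p dvd d" "\<not> p dvd e" using d e dvd_trans by blast+
      then show ?thesis by (simp add: not_dvd_imp_multiplicity_0)
    qed
    with pos show "d = e" by (rule multiplicity_eq_nat)
  qed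
  moreover have "?F ` {d. d dvd n} \<subseteq> (\<Pi>\<^sub>E p\<in>?P. {..multiplicity p n})"
    using assms by (auto intro!: dvd_imp_multiplicity_le)
  moreover have "finite (\<Pi>\<^sub>E p\<in>?P. {..multiplicity p n})"
    by (intro finite_PiE) auto
  ultimately have "card {d. d dvd n} \<le> card (\<Pi>\<^sub>E p\<in>?P. {..multiplicity p n})"
    by (rule card_inj_on_le)
  also have "\<dots> = (\<Prod>p\<in>?P. multiplicity p n + 1)"
    by (simp add: card_PiE)
  finally show ?thesis .
qed

text \<open>The contribution of a single prime power to the divisor bound. Beyond the cutoff,
  \<open>x powr \<delta>\<close> is at least 2, and \<open>2 ^ a\<close> already dominates
  \<open>a + 1\<close>. Below it only \<open>x \<ge> 2\<close> is used: the linear lower bound for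
  the exponential is too small by a factor of at most
  \<open>1 + 1 / (\<delta> * ln 2)\<close>.\<close>

lemma Suc_le_powr_mult:
  fixes \<delta> x :: real
  assumes "\<delta> > 0" "x \<ge> 2"
  shows "real a + 1 \<le> (x ^ a) powr \<delta> * (if x \<le> 2 powr (1 / \<delta>) then 1 + 1 / (\<delta> * ln 2) else 1)"
proof -
  have x: "(x ^ a) powr \<delta> = (x powr \<delta>) powr a"
    using assms by (simp add: powr_powr mult.commute flip: powr_realpow)
  show ?thesis
  proof (cases "x \<le> 2 powr (1 / \<delta>)")
    case True
    define t where "t = \<delta> * ln 2"
    have t: "t > 0" using assms by (simp add: t_def)
    have "1 + real a * t \<le> exp (real a * t)" by (rule exp_ge_add_one_self)
    also have "\<dots> = (2 powr \<delta>) powr a"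
      by (simp add: powr_def t_def mult_ac)
    also have "\<dots> \<le> (x powr \<delta>) powr a"
      using assms by (intro powr_mono2) auto
    finally have "(1 + real a * t) * (1 + 1 / t) \<le> (x ^ a) powr \<delta> * (1 + 1 / t)"
      unfolding x using t by (intro mult_right_mono) auto
    \<comment> \<open>Expanding the right-hand side gives \<open>1 + a\<close> plus the nonnegative
      terms \<open>a * t\<close> and \<open>1 / t\<close>.\<close>
    moreover have "real a + 1 \<le> (1 + real a * t) * (1 + 1 / t)"
      using t by (simp add: field_simps)
    ultimately show ?thesis using True by (simp add: t_def)
  next
    case False
    have "2 = (2 powr (1 / \<delta>)) powr \<delta>" using assms by (simp add: powr_powr)
    also have "\<dots> \<le> x powr \<delta>" using assms False by (intro powr_mono2) auto
    finally have "2 powr a \<le> (x powr \<delta>) powr a" by (intro powr_mono2) auto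
    moreover have "real a + 1 \<le> 2 powr a"
    proof -
      have "Suc a \<le> 2 ^ a" by (induction a) auto
      then have "real (Suc a) \<le> real (2 ^ a)" by (rule of_nat_mono)
      then show ?thesis by (simp add: powr_realpow)
    qed
    ultimately show ?thesis using False x by simp
  qed
qed

text \<open>The one-prime estimate is multiplied over the prime factors. The powers of primes
  recombine to \<open>n powr \<delta>\<close>, and the constant is paid only for primes up to the
  cutoff \<open>2 powr (1 / \<delta>)\<close>. Leaving \<open>\<delta>\<close> free allows it to be
  tuned to the size of the argument later.\<close>

lemma card_divisors_powr_bound:
  fixes n :: nat and \<delta> :: real
  assumes "n > 0" "\<delta> > 0"
  shows "real (card {d. d dvd n}) \<le> real n powr \<delta> * (1 + 1 / (\<delta> * ln 2)) powr (2 powr (1 / \<delta>))"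
proof -
  let ?P = "prime_factors n"
  define Y where "Y = 2 powr (1 / \<delta>)"
  define K where "K = 1 + 1 / (\<delta> * ln 2)"
  have K: "K \<ge> 1" using assms by (simp add: K_def)
  have prod_powr: "(\<Prod>p\<in>A. f p powr \<delta>) = (\<Prod>p\<in>A. f p) powr \<delta>"
    if "\<And>p. p \<in> A \<Longrightarrow> f p \<ge> 0" for A and f :: "nat \<Rightarrow> real"
    using that by (simp add: prod_powr_distrib)
  have "real (card {d. d dvd n}) \<le> real (\<Prod>p\<in>?P. multiplicity p n + 1)"
    using card_divisors_le[OF assms(1)] by (rule of_nat_mono)
  also have "\<dots> = (\<Prod>p\<in>?P. real (multiplicity p n) + 1)" by (simp add: add_ac)
  also have "\<dots> \<le> (\<Prod>p\<in>?P. (real p ^ multiplicity p n) powr \<delta> * (if real p \<le> Y then K else 1))"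
    unfolding Y_def K_def using assms
    by (intro prod_mono conjI Suc_le_powr_mult) (auto dest: prime_ge_2_nat simp: in_prime_factors_iff)
  also have "\<dots> = (\<Prod>p\<in>?P. real p ^ multiplicity p n) powr \<delta> * (\<Prod>p\<in>?P. if real p \<le> Y then K else 1)"
    by (simp add: prod.distrib prod_powr)
  also have "(\<Prod>p\<in>?P. real p ^ multiplicity p n) = real n"
    using prime_factorization_nat[OF assms(1)] by (metis (no_types, lifting) of_nat_power of_nat_prod prod.cong)
  also have "(\<Prod>p\<in>?P. if real p \<le> Y then K else 1) = K ^ card {p\<in>?P. real p \<le> Y}"
    by (simp flip: prod.inter_filter)
  also have "\<dots> \<le> K powr Y"
  proof -
    \<comment> \<open>The small primes are counted crudely, as if every positive integer up to
      \<open>Y\<close> were one of them.\<close>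
    have "{p\<in>?P. real p \<le> Y} \<subseteq> {1..nat \<lfloor>Y\<rfloor>}"
      by (auto simp: le_nat_floor in_prime_factors_iff dest: prime_gt_0_nat)
    then have "card {p\<in>?P. real p \<le> Y} \<le> nat \<lfloor>Y\<rfloor>"
      using card_mono[of "{1..nat \<lfloor>Y\<rfloor>}"] by fastforce
    then have "real (card {p\<in>?P. real p \<le> Y}) \<le> Y"
      by (simp add: Y_def le_nat_iff le_floor_iff)
    then show ?thesis using K by (simp add: powr_mono flip: powr_realpow)
  qed
  finally show ?thesis by (simp add: mult_left_mono K_def Y_def)
qed

text \<open>Every common element is the value of one explicit map at some divisor, so the
  intersection lies in the image of the divisor set. The hypotheses make
  \<open>m\<^sup>2 - n\<^sup>2\<close> positive, so that this set is finite.\<close>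

lemma card_A_set_Int_le:
  fixes m n :: int
  assumes "m > n" "n > 0"
  shows "card (A_set n \<inter> A_set m) \<le> card {d. d dvd nat (m\<^sup>2 - n\<^sup>2)}"
proof -
  define N where "N = m\<^sup>2 - n\<^sup>2"
  have N: "N > 0" using assms by (simp add: N_def power_strict_mono)
  \<comment> \<open>Inverts the parametrization: for \<open>d = \<bar>u + v\<bar>\<close> the
    cofactor is \<open>\<bar>u - v\<bar>\<close>, half the difference is \<open>v\<close> up to
    sign, and completing the square gives \<open>n\<^sup>2 - v\<^sup>2 = 4 * x\<close>. Squaring
    removes the sign ambiguity.\<close>
  define g :: "nat \<Rightarrow> int" where "g d = (n\<^sup>2 - ((int d - N div int d) div 2)\<^sup>2) div 4" for d
  have "A_set n \<inter> A_set m \<subseteq> g ` {d. d dvd nat N}"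
  proof
    fix x assume "x \<in> A_set n \<inter> A_set m"
    then have "x \<in> A_set n" "x \<in> A_set m" by auto
    then obtain r s where r: "x = r * (n - r)" and s: "x = s * (m - s)"
      unfolding A_set_def by blast
    define u v where "u = m - 2 * s" and "v = n - 2 * r"
    have uv: "(u + v) * (u - v) = N"
      using r s unfolding u_def v_def N_def by (simp add: algebra_simps power2_eq_square)
    have nz: "u + v \<noteq> 0" using uv N by auto
    have abs: "\<bar>u + v\<bar> * \<bar>u - v\<bar> = N" using uv N by (simp flip: abs_mult)
    have quot: "N div \<bar>u + v\<bar> = \<bar>u - v\<bar>"
      unfolding abs[symmetric] using nz by simp
    \<comment> \<open>Since \<open>N > 0\<close>, the factors \<open>u + v\<close> and
      \<open>u - v\<close> have the same sign, so the absolute values differ by exactly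
      \<open>2 * v\<close> or its negative.\<close>
    have "(\<bar>u + v\<bar> - \<bar>u - v\<bar>) div 2 = v \<or> (\<bar>u + v\<bar> - \<bar>u - v\<bar>) div 2 = - v"
    proof (cases "u + v > 0")
      case True
      then have "u - v > 0" using uv N by (metis zero_less_mult_pos)
      then show ?thesis using True by auto
    next
      case False
      then have "u + v < 0" using nz by simp
      then have "u - v < 0" using uv N by (metis mult_less_0_iff not_less_iff_gr_or_eq mult_zero_right)
      then show ?thesis using False by auto
    qed
    then have "((\<bar>u + v\<bar> - \<bar>u - v\<bar>) div 2)\<^sup>2 = v\<^sup>2" by auto
    moreover have "n\<^sup>2 - v\<^sup>2 = 4 * x"
      unfolding v_def r by (simp add: algebra_simps power2_eq_square)
    ultimately have "g (nat \<bar>u + v\<bar>) = x"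
      by (simp add: g_def quot)
    moreover have "nat \<bar>u + v\<bar> dvd nat N"
      using abs by (metis abs_ge_zero dvd_triv_left nat_mult_distrib)
    ultimately show "x \<in> g ` {d. d dvd nat N}" by force
  qed
  moreover have fin: "finite {d. d dvd nat N}" using N by simp
  ultimately have "card (A_set n \<inter> A_set m) \<le> card (g ` {d. d dvd nat N})"
    by (intro card_mono) auto
  also have "\<dots> \<le> card {d. d dvd nat N}" using fin by (rule card_image_le)
  finally show ?thesis by (simp add: N_def)
qed

theorem corollary1p2:
  shows "\<forall>\<epsilon>::real. \<epsilon> > 0 \<longrightarrow>
    (\<exists>n\<^sub>0::int. \<forall>m n :: int. m > n \<and> n > n\<^sub>0 \<longrightarrow>
      real (card (A_set n \<inter> A_set m))
        < real_of_int m powr ((2 + \<epsilon>) * ln 2 / ln (ln (real_of_int m))))"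
proof (intro allI impI)
  fix \<epsilon> :: real assume \<epsilon>: "\<epsilon> > 0"
  \<comment> \<open>The budget \<open>\<epsilon>\<close> is split in half. The factor
    \<open>N powr \<delta> x\<close> with \<open>N \<le> x\<^sup>2\<close> contributes
    \<open>2 * c = 2 + \<epsilon> / 2\<close> to the coefficient of
    \<open>ln 2 * ln x / ln (ln x)\<close>, leaving \<open>\<epsilon> / 2\<close> for the small
    primes.\<close>
  define c where "c = 1 + \<epsilon> / 4"
  define \<delta> where "\<delta> x = c * ln 2 / ln (ln x)" for x :: real
  have c: "c > 1" using \<epsilon> by (simp add: c_def)
  \<comment> \<open>With this \<open>\<delta> x\<close> the cutoff
    \<open>2 powr (1 / \<delta> x)\<close> equals \<open>ln x powr b\<close>. Because
    \<open>b < 1\<close>, the small-prime term stays below any positive multiple of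
    \<open>ln x / ln (ln x)\<close> for large \<open>x\<close>, even with its extra logarithmic
    factor.\<close>
  define b where "b = 1 / c"
  have b: "b > 0" "b < 1" using c by (auto simp: b_def)
  have "eventually (\<lambda>x::real. ln x powr b * ln (1 + b / (ln 2)\<^sup>2 * ln (ln x))
      < \<epsilon> / 2 * ln 2 * ln x / ln (ln x)) at_top"
    using \<epsilon> b by real_asymp
  moreover have "eventually (\<lambda>x::real. ln (ln x) > 0) at_top" by real_asymp
  moreover have "eventually (\<lambda>x::real. x > 1) at_top" by real_asymp
  ultimately have "eventually (\<lambda>x::real. x > 1 \<and> ln (ln x) > 0 \<and>
      ln x powr b * ln (1 + b / (ln 2)\<^sup>2 * ln (ln x))
      < \<epsilon> / 2 * ln 2 * ln x / ln (ln x)) at_top"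
    by eventually_elim auto
  then obtain x0 where x0: "\<And>x. x \<ge> x0 \<Longrightarrow> x > 1 \<and> ln (ln x) > 0 \<and>
      ln x powr b * ln (1 + b / (ln 2)\<^sup>2 * ln (ln x)) < \<epsilon> / 2 * ln 2 * ln x / ln (ln x)"
    by (auto simp: eventually_at_top_linorder)
  show "\<exists>n\<^sub>0::int. \<forall>m n :: int. m > n \<and> n > n\<^sub>0 \<longrightarrow>
      real (card (A_set n \<inter> A_set m))
        < real_of_int m powr ((2 + \<epsilon>) * ln 2 / ln (ln (real_of_int m)))"
  \<comment> \<open>The 0 ensures \<open>n > 0\<close> for the divisor count; the ceiling ensures
    that \<open>m\<close> passes the analytic threshold.\<close>
  proof (intro exI[of _ "max 0 \<lceil>x0\<rceil>"] allI impI)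
    fix m n :: int assume mn: "m > n \<and> n > max 0 \<lceil>x0\<rceil>"
    define x where "x = real_of_int m"
    define L where "L = ln (ln x)"
    have "x \<ge> x0" using mn unfolding x_def by linarith
    from x0[OF this] have x: "x > 1" and L: "L > 0" and
      bound: "ln x powr b * ln (1 + b / (ln 2)\<^sup>2 * L) < \<epsilon> / 2 * ln 2 * ln x / L"
      by (auto simp: L_def)
    have lnx: "ln x > 0" using x by simp
    have \<delta>: "\<delta> x > 0" using c L by (simp add: \<delta>_def L_def)
    define N where "N = nat (m\<^sup>2 - n\<^sup>2)"
    have N: "N > 0" using mn by (simp add: N_def power_strict_mono)
    have Nx: "real N \<le> x\<^sup>2" using mn by (simp add: N_def x_def power_mono)
    define K where "K = 1 + 1 / (\<delta> x * ln 2)"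
    have K_eq: "K = 1 + b / (ln 2)\<^sup>2 * L"
      by (simp add: K_def \<delta>_def b_def L_def power2_eq_square)
    have K: "K > 0" using b L by (simp add: K_eq add_pos_nonneg)
    have "2 powr (1 / \<delta> x) = ln x powr b"
      using lnx c by (simp add: powr_def \<delta>_def b_def)
    then have Y: "K powr (2 powr (1 / \<delta> x)) = exp (ln x powr b * ln K)"
      using K by (simp add: powr_def)
    have "real (card (A_set n \<inter> A_set m)) \<le> real (card {d. d dvd N})"
      using card_A_set_Int_le[of n m] mn by (simp add: N_def)
    also have "\<dots> \<le> real N powr \<delta> x * K powr (2 powr (1 / \<delta> x))"
      unfolding K_def by (rule card_divisors_powr_bound[OF N \<delta>])
    also have "\<dots> \<le> (x\<^sup>2) powr \<delta> x * K powr (2 powr (1 / \<delta> x))"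
      using Nx \<delta> by (intro mult_right_mono powr_mono2) auto
    also have "\<dots> = exp (2 * \<delta> x * ln x + ln x powr b * ln K)"
      using x unfolding Y by (simp add: powr_def exp_add ln_realpow)
    also have "\<dots> < exp (2 * \<delta> x * ln x + \<epsilon> / 2 * ln 2 * ln x / L)"
      using bound by (simp add: K_eq)
    also have "2 * \<delta> x * ln x + \<epsilon> / 2 * ln 2 * ln x / L = (2 + \<epsilon>) * ln 2 / L * ln x"
      using L by (simp add: \<delta>_def c_def field_simps flip: L_def)
    also have "exp \<dots> = x powr ((2 + \<epsilon>) * ln 2 / L)"
      using x by (simp add: powr_def)
    finally show "real (card (A_set n \<inter> A_set m))
        < real_of_int m powr ((2 + \<epsilon>) * ln 2 / ln (ln (real_of_int m)))"
      by (simp add: x_def L_def)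
  qed
qed

end
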